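(* Fix a weak-GMM limit experiment $(\alpha_W^*,m)$, a matrix $B$ with $d_W$ columns, a measurable benchmark rule $t_0$, and a measurable pooled rule $t_\lambda$ (both maps $g\mapsto t(g)\in\mathbb R^{d_W}$). Put $e_0(g)=B(t_0(g)-\alpha_W^* )$ and $d_\lambda(g)=t_\lambda(g)-t_0(g)$. If $M_B(t_0;\alpha_W^*,m)<\infty$ and $M_B(t_\lambda;\alpha_W^*,m)<\infty$, then $Bd_\lambda$ is square integrable, $e_0'Bd_\lambda$ is integrable, and $$M_B(t_\lambda;\alpha_W^*,m)-M_B(t_0;\alpha_W^*,m)=2\,\mathbb E_m\bigl[e_0(g)'Bd_\lambda(g)\bigr]+\mathbb E_m\bigl\|Bd_\lambda(g)\bigr\|^2.$$
   Context: A weak-GMM limit experiment is a pair $(\alpha_W^*,m)$ where $\alpha_W^*$ lies in a compact set $\mathcal W\subset\mathbb R^{d_W}$ and $m:\mathcal W\to\mathbb R^{k_W}$ is a drift function with $m(\alpha_W^* )=0$; the observed random process is $g=m+\mathbb G$ on $\mathcal W$ with $\mathbb G$ mean-zero Gaussian with continuous sample paths, and $\mathbb E_m$ denotes expectation over $g$ with $(\alpha_W^*,m)$ held fixed. For a measurable rule $t:g\mapsto t(g)\in\mathbb R^{d_W}$, $M_B(t;\alpha_W^*,m)=\mathbb E_m\|B(t(g)-\alpha_W^* )\|^2\in[0,\infty]$. *)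

theory Defs
  imports "HOL-Probability.Probability"
begin

text \<open>
  Degenerate laws (\<open>\<sigma> = 0\<close>) count as Gaussian: a Gaussian process may have
  variance zero in some directions or at some points.
\<close>

definition centered_gaussian :: "'w measure \<Rightarrow> ('w \<Rightarrow> real) \<Rightarrow> bool" where
  "centered_gaussian M X \<longleftrightarrow> X \<in> borel_measurable M \<and>
     (\<exists>\<sigma>\<ge>0. distr M borel X =
        (if \<sigma> = 0 then return borel 0 else density lborel (\<lambda>x. ennreal (normal_density 0 \<sigma> x))))"

text \<open>
  Joint Gaussianity of the finite-dimensional distributions is expressed, as usual, by
  Gaussianity of every finite linear combination of coordinates of the process.
\<close>

definition centered_gaussian_process ::
    "'w measure \<Rightarrow> 'a set \<Rightarrow> ('w \<Rightarrow> 'a \<Rightarrow> 'b::euclidean_space) \<Rightarrow> bool" where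
  "centered_gaussian_process M W G \<longleftrightarrow>
     (\<forall>F c. finite F \<longrightarrow> F \<subseteq> W \<longrightarrow> centered_gaussian M (\<lambda>\<omega>. \<Sum>a\<in>F. c a \<bullet> G \<omega> a))"

locale weak_gmm_experiment = prob_space M
  for M :: "'w measure"
    and G :: "'w \<Rightarrow> real ^ 'd \<Rightarrow> real ^ 'k"
    and W :: "(real ^ 'd) set"
    and \<alpha> :: "real ^ 'd"
    and m :: "real ^ 'd \<Rightarrow> real ^ 'k" +
  assumes compact_W: "compact W"
    and true_in_W: "\<alpha> \<in> W"
    and drift_zero: "m \<alpha> = 0"
    and gaussian: "centered_gaussian_process M W G"
    and continuous_paths: "\<And>\<omega>. \<omega> \<in> space M \<Longrightarrow> continuous_on W (G \<omega>)"

definition observed :: "('w \<Rightarrow> 'a \<Rightarrow> 'b::euclidean_space) \<Rightarrow> 'a set \<Rightarrow> ('a \<Rightarrow> 'b) \<Rightarrow> 'w \<Rightarrow> 'a \<Rightarrow> 'b" where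
  "observed G W m \<omega> = (\<lambda>a\<in>W. m a + G \<omega> a)"

text \<open>
  The possible realisations of \<open>m + G\<close> are the functions on \<open>W\<close> differing from \<open>m\<close> by a
  continuous function (just the continuous functions if \<open>m\<close> is continuous), with the
  \<open>\<sigma>\<close>-algebra generated by point evaluations; for continuous \<open>m\<close> and compact \<open>W\<close> this is the
  Borel \<open>\<sigma>\<close>-algebra of the supremum norm.  The restriction to these paths matters:
  path functionals such as suprema and minimisers need not be measurable on the unrestricted
  product space.  A rule that is measurable on any larger space of paths, with the evaluation
  \<open>\<sigma>\<close>-algebra, is measurable here.
\<close>

definition path_space ::
    "('a::topological_space) set \<Rightarrow> ('a \<Rightarrow> 'b::euclidean_space) \<Rightarrow> ('a \<Rightarrow> 'b) measure" where
  "path_space W m =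
     restrict_space (PiM W (\<lambda>_. borel)) {g. continuous_on W (\<lambda>a. g a - m a)}"

text \<open>The law of the observed process; the expectation given \<open>m\<close> is integration against it.\<close>

definition obs_law ::
    "'w measure \<Rightarrow> ('w \<Rightarrow> 'a \<Rightarrow> 'b) \<Rightarrow> ('a::topological_space) set \<Rightarrow>
     ('a \<Rightarrow> 'b::euclidean_space) \<Rightarrow> ('a \<Rightarrow> 'b) measure" where
  "obs_law M G W m = distr M (path_space W m) (observed G W m)"

definition risk ::
    "('g measure) \<Rightarrow> real ^ 'd ^ 'r \<Rightarrow> ('g \<Rightarrow> real ^ 'd) \<Rightarrow> real ^ 'd \<Rightarrow> ennreal" where
  "risk P B t \<alpha> = (\<integral>\<^sup>+ g. ennreal ((norm (B *v (t g - \<alpha>)))\<^sup>2) \<partial>P)"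

definition square_integrable :: "'g measure \<Rightarrow> ('g \<Rightarrow> 'b::euclidean_space) \<Rightarrow> bool" where
  "square_integrable P f \<longleftrightarrow> f \<in> borel_measurable P \<and> integrable P (\<lambda>g. (norm (f g))\<^sup>2)"

text \<open>
  The push-forward defining the law is a genuine one: \<open>distr\<close> along a non-measurable map would
  not be a probability measure.
\<close>

lemma (in weak_gmm_experiment) observed_measurable:
  "observed G W m \<in> measurable M (path_space W m)"
proof -
  have G: "(\<lambda>\<omega>. G \<omega> a) \<in> borel_measurable M" if a: "a \<in> W" for a
  proof (rule borel_measurable_euclidean_space[THEN iffD2], rule ballI)
    fix i :: "real ^ 'k"
    have "centered_gaussian M (\<lambda>\<omega>. \<Sum>b\<in>{a}. (\<lambda>_. i) b \<bullet> G \<omega> b)"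
      by (rule gaussian[unfolded centered_gaussian_process_def, rule_format]) (use a in auto)
    then show "(\<lambda>\<omega>. G \<omega> a \<bullet> i) \<in> borel_measurable M"
      by (simp add: centered_gaussian_def inner_commute)
  qed
  have "observed G W m \<in> measurable M (PiM W (\<lambda>_. borel))"
    unfolding observed_def using G by (intro measurable_restrict) simp
  moreover have "continuous_on W (\<lambda>a. observed G W m \<omega> a - m a)" if "\<omega> \<in> space M" for \<omega>
  proof (rule continuous_on_eq[OF continuous_paths[OF that]])
    show "G \<omega> a = observed G W m \<omega> a - m a" if "a \<in> W" for a
      using that by (simp add: observed_def)
  qed
  ultimately show ?thesis
    unfolding path_space_def by (intro measurable_restrict_space2) auto
qed

lemma (in weak_gmm_experiment) prob_space_obs_law: "prob_space (obs_law M G W m)"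
  unfolding obs_law_def by (rule prob_space_distr[OF observed_measurable])

end

theory Submission
  imports Defs
begin

text \<open>By linearity of \<open>B\<close>, the error of the pooled rule is
  \<open>e0 g + B *v d g\<close>, so the claim is the expansion of a squared norm, integrated term
  by term. What needs proof is that each term has a finite integral. Finite risk puts both errors in
  L2 (\<open>square_integrable_risk\<close>). Their difference \<open>B *v d g\<close> is then in L2
  (\<open>square_integrable_diff\<close>), and the cross term is integrable by Cauchy-Schwarz
  (\<open>square_integrable_inner\<close>). Since both risks are finite, \<open>enn2real\<close>
  loses nothing and the subtraction is a genuine one.\<close>

lemma square_integrable_inner:
  assumes "square_integrable P u" "square_integrable P v"
  shows "integrable P (\<lambda>x. u x \<bullet> v x)"
proof (rule Bochner_Integration.integrable_bound)
  show "integrable P (\<lambda>x. (norm (u x))\<^sup>2 + (norm (v x))\<^sup>2)"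
    using assms by (simp add: square_integrable_def)
  show "(\<lambda>x. u x \<bullet> v x) \<in> borel_measurable P"
    using assms by (auto simp: square_integrable_def)
  have "norm (u x \<bullet> v x) \<le> norm ((norm (u x))\<^sup>2 + (norm (v x))\<^sup>2)" for x
  proof -
    have "norm (u x \<bullet> v x) \<le> norm (u x) * norm (v x)"
      by (simp add: Cauchy_Schwarz_ineq2)
    \<comment> \<open>For a, b \<ge> 0, ab \<le> 2ab \<le> a^2 + b^2; dropping the factor 1/2 keeps
      the dominating function simple.\<close>
    also have "\<dots> \<le> (norm (u x))\<^sup>2 + (norm (v x))\<^sup>2"
      using sum_squares_bound[of "norm (u x)" "norm (v x)"] mult_nonneg_nonneg[OF norm_ge_zero norm_ge_zero, of "u x" "v x"]
      by linarith
    finally show ?thesis by simp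
  qed
  then show "AE x in P. norm (u x \<bullet> v x) \<le> norm ((norm (u x))\<^sup>2 + (norm (v x))\<^sup>2)"
    by simp
qed

lemma square_integrable_diff:
  assumes "square_integrable P u" "square_integrable P v"
  shows "square_integrable P (\<lambda>x. u x - v x)"
proof -
  have "integrable P (\<lambda>x. (norm (u x))\<^sup>2 + (norm (v x))\<^sup>2 - 2 * (u x \<bullet> v x))"
    using assms square_integrable_inner[OF assms] by (simp add: square_integrable_def)
  then have "integrable P (\<lambda>x. (norm (u x - v x))\<^sup>2)"
    by (simp add: power2_norm_eq_inner inner_diff inner_commute algebra_simps)
  then show ?thesis
    using assms by (auto simp: square_integrable_def)
qed

text \<open>L2 membership is what licenses the splitting: all three terms are integrable, so none of
  the integrals is the default value 0.\<close>

lemma integral_norm_square_add: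
  assumes "square_integrable P u" "square_integrable P v"
  shows "(\<integral>x. (norm (u x + v x))\<^sup>2 \<partial>P) =
    (\<integral>x. (norm (u x))\<^sup>2 \<partial>P) + 2 * (\<integral>x. u x \<bullet> v x \<partial>P) + (\<integral>x. (norm (v x))\<^sup>2 \<partial>P)"
proof -
  have "(\<integral>x. (norm (u x + v x))\<^sup>2 \<partial>P) =
      (\<integral>x. (norm (u x))\<^sup>2 + 2 * (u x \<bullet> v x) + (norm (v x))\<^sup>2 \<partial>P)"
    by (simp add: power2_norm_eq_inner inner_add inner_commute algebra_simps)
  also have "\<dots> = (\<integral>x. (norm (u x))\<^sup>2 \<partial>P) + 2 * (\<integral>x. u x \<bullet> v x \<partial>P) + (\<integral>x. (norm (v x))\<^sup>2 \<partial>P)"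
    using assms square_integrable_inner[OF assms] by (simp add: square_integrable_def)
  finally show ?thesis .
qed

text \<open>A linear map in finite dimension is continuous, hence Borel.\<close>

lemma borel_measurable_matrix_vector_mult [measurable (raw)]:
  fixes B :: "real ^ 'd ^ 'r"
  assumes "f \<in> borel_measurable P"
  shows "(\<lambda>x. B *v f x) \<in> borel_measurable P"
  using measurable_compose[OF assms borel_measurable_continuous_onI]
  by (metis linear_continuous_on matrix_vector_mul_bounded_linear)

lemma square_integrable_risk:
  assumes "t \<in> borel_measurable P" "risk P B t \<alpha> < \<infinity>"
  shows "square_integrable P (\<lambda>g. B *v (t g - \<alpha>))"
  using assms by (auto simp: square_integrable_def risk_def integrable_iff_bounded)

text \<open>This holds for infinite risk too: then \<open>enn2real\<close> and the Bochner integral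
  both default to 0.\<close>

lemma enn2real_risk:
  assumes "t \<in> borel_measurable P"
  shows "enn2real (risk P B t \<alpha>) = (\<integral>g. (norm (B *v (t g - \<alpha>)))\<^sup>2 \<partial>P)"
  unfolding risk_def using assms by (subst integral_eq_nn_integral) auto

theorem proposition4p1:
  fixes M :: "'w measure"
    and G :: "'w \<Rightarrow> real ^ 'd \<Rightarrow> real ^ 'k"
    and W :: "(real ^ 'd) set"
    and \<alpha> :: "real ^ 'd"
    and m :: "real ^ 'd \<Rightarrow> real ^ 'k"
    and B :: "real ^ 'd ^ 'r"
    and t0 tl :: "(real ^ 'd \<Rightarrow> real ^ 'k) \<Rightarrow> real ^ 'd"
  defines "P \<equiv> obs_law M G W m"
    and "e0 \<equiv> \<lambda>g. B *v (t0 g - \<alpha>)"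
    and "d \<equiv> \<lambda>g. tl g - t0 g"
  assumes "weak_gmm_experiment M G W \<alpha> m"
    and "t0 \<in> borel_measurable (path_space W m)"
    and "tl \<in> borel_measurable (path_space W m)"
    and "risk P B t0 \<alpha> < \<infinity>"
    and "risk P B tl \<alpha> < \<infinity>"
  shows "square_integrable P (\<lambda>g. B *v d g) \<and>
         integrable P (\<lambda>g. e0 g \<bullet> (B *v d g)) \<and>
         enn2real (risk P B tl \<alpha>) - enn2real (risk P B t0 \<alpha>) =
           2 * (\<integral>g. e0 g \<bullet> (B *v d g) \<partial>P) + (\<integral>g. (norm (B *v d g))\<^sup>2 \<partial>P)"
proof -
  define e1 where "e1 = (\<lambda>g. B *v (tl g - \<alpha>))"
  \<comment> \<open>A push-forward carries the sigma-algebra of its target, here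
    \<open>path_space W m\<close>.\<close>
  have meas: "t0 \<in> borel_measurable P" "tl \<in> borel_measurable P"
    using assms by (simp_all add: P_def obs_law_def)
  have e0: "square_integrable P e0"
    unfolding e0_def using meas assms by (intro square_integrable_risk) auto
  have e1: "square_integrable P e1"
    unfolding e1_def using meas assms by (intro square_integrable_risk) auto
  \<comment> \<open>The true parameter \<open>\<alpha>\<close> cancels in the difference of the two
    errors.\<close>
  have Bd: "B *v d g = e1 g - e0 g" for g
    by (simp add: d_def e0_def e1_def flip: matrix_vector_mult_diff_distrib)
  have sq: "square_integrable P (\<lambda>g. B *v d g)"
    unfolding Bd by (rule square_integrable_diff[OF e1 e0])
  have "enn2real (risk P B tl \<alpha>) = (\<integral>g. (norm (e0 g + B *v d g))\<^sup>2 \<partial>P)"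
    by (simp add: enn2real_risk[OF meas(2)] Bd e1_def)
  moreover have "enn2real (risk P B t0 \<alpha>) = (\<integral>g. (norm (e0 g))\<^sup>2 \<partial>P)"
    by (simp add: enn2real_risk[OF meas(1)] e0_def)
  ultimately show ?thesis
    using sq square_integrable_inner[OF e0 sq] integral_norm_square_add[OF e0 sq] by simp
qed

end
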